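(* Let $g:\{0,1\}^n\to\mathbb{R}$ be submodular with $g(\mathbf 0)=0$, let $\mathsf G$ be its extended envelope, let $\ell\in\{0,1\}$, and let $\mathcal{C}:=\{(x,t)\in\mathbb{R}^n\times\mathbb{R}:\mathsf G(x)\le\ell t\}$. Let $z^*=(\tilde x,\tilde t)\in\mathrm{int}(\mathcal{C})$ be the vertex of a corner polyhedron, let $r=(r_x,r_t)\in\mathbb{R}^n\times\mathbb{R}$ be one of its extreme rays, let $\eta^*:=\sup\{\eta\ge 0: z^*+\eta r\in\mathcal{C}\}$, and define $\zeta:\mathbb{R}_+\to\mathbb{R}$ by $\zeta(\eta):=\ell(\tilde t+r_t\eta)-\mathsf G(\tilde x+r_x\eta)$. Then the hybrid discrete Newton algorithm applied to $\zeta$ terminates in a finite number of steps and finds the zero point $\eta^*$ of $\zeta$.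
   Context: $g$ is submodular if $g(x)+g(y)\ge g(x\vee y)+g(x\wedge y)$ for all $x,y\in\{0,1\}^n$ (componentwise max and min). The product $sx$ of two vectors is the inner product. $EPM_g:=\{s\in\mathbb{R}^n: sx\le g(x)\ \forall x\in\{0,1\}^n\}$, $\mathrm{ext}(EPM_g)$ is its vertex set, and the extended envelope is $\mathsf G(x):=\max_{s\in\mathrm{ext}(EPM_g)}sx$ for $x\in\mathbb{R}^n$. A corner polyhedron with vertex $z^*$ is a set $\{z^*+\sum_{j=1}^{n+1}\eta_j r^j:\eta_j\ge0\}$ with linearly independent extreme rays $r^1,\dots,r^{n+1}\in\mathbb{R}^{n+1}$. Hybrid discrete Newton algorithm. Input: the univariate function $\zeta$, a scalar starting point $\Delta>0$ (default 0.2), a number $\eta_\infty$ representing $+\infty$, and a maximum number $I$ of search steps (default 500). Intended output: $\eta>0$ with $\zeta(\eta)=0$. Set $i:=0$, $\eta:=\Delta$. If $\zeta(\eta_\infty)>0$, set $\eta:=\eta_\infty$ (safeguard). Otherwise, while $i<I$: let $s^*\in\arg\max_{s\in\mathrm{ext}(EPM_g)}s(\tilde x+r_x\eta)$ and compute the subgradient $\beta:=\ell r_t-s^*r_x$; if $\zeta(\eta)=0$, break; else if $\beta<0$, set $\eta:=\eta-\zeta(\eta)/\beta$ (Newton step); else set $\eta:=2\eta$ (bisection step); then set $i:=i+1$.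
   Formalization: If ℓ=0 and G(x̃)=0, where ζ vanishes on an interval and the claim can fail, only finite termination at some positive zero of ζ is claimed; if η* is infinite the output is η_∞; η_∞ is assumed at least any finite η*, and the step limit I is taken large enough. *)

theory Defs
  imports "HOL-Analysis.Analysis" "HOL-Library.While_Combinator" "HOL-Library.Extended_Nat"
begin

definition binary :: "(real^'n) set" where
  "binary = {x. \<forall>i. x $ i \<in> {0, 1}}"

text \<open>
  Set functions are functions on \<open>real^'n\<close>; only their values on \<open>binary\<close> matter.
  On \<open>real^'n\<close>, \<open>sup\<close> and \<open>inf\<close> are the componentwise maximum and minimum.
\<close>

definition submodular :: "(real^'n \<Rightarrow> real) \<Rightarrow> bool" where
  "submodular g \<longleftrightarrow>
     (\<forall>x\<in>binary. \<forall>y\<in>binary. g x + g y \<ge> g (sup x y) + g (inf x y))"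

definition EPM :: "(real^'n \<Rightarrow> real) \<Rightarrow> (real^'n) set" where
  "EPM g = {s. \<forall>x\<in>binary. s \<bullet> x \<le> g x}"

definition ext_envelope :: "(real^'n \<Rightarrow> real) \<Rightarrow> real^'n \<Rightarrow> real" where
  "ext_envelope g x = Max ((\<lambda>s. s \<bullet> x) ` {s. s extreme_point_of EPM g})"

definition envelope_set :: "(real^'n \<Rightarrow> real) \<Rightarrow> real \<Rightarrow> ((real^'n) \<times> real) set" where
  "envelope_set g l = {(x, t). ext_envelope g x \<le> l * t}"

text \<open>\<open>P\<close> is the corner polyhedron with vertex \<open>z\<close> and set of extreme rays \<open>R\<close>.\<close>

definition corner_polyhedron ::
    "((real^'n) \<times> real) set \<Rightarrow> (real^'n) \<times> real \<Rightarrow> ((real^'n) \<times> real) set \<Rightarrow> bool" where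
  "corner_polyhedron P z R \<longleftrightarrow>
     independent R \<and> card R = CARD('n) + 1 \<and>
     P = {z + (\<Sum>r\<in>R. c r *\<^sub>R r) | c. \<forall>r\<in>R. 0 \<le> c r}"

text \<open>The value is \<open>\<infinity>\<close> exactly when the ray never leaves the set.\<close>

definition step_length ::
    "(real^'n \<Rightarrow> real) \<Rightarrow> real \<Rightarrow> (real^'n) \<times> real \<Rightarrow> (real^'n) \<times> real \<Rightarrow> ereal" where
  "step_length g l z r = (SUP \<eta>\<in>{\<eta>. 0 \<le> \<eta> \<and> z + \<eta> *\<^sub>R r \<in> envelope_set g l}. ereal \<eta>)"

definition zeta ::
    "(real^'n \<Rightarrow> real) \<Rightarrow> real \<Rightarrow> (real^'n) \<times> real \<Rightarrow> (real^'n) \<times> real \<Rightarrow> real \<Rightarrow> real" where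
  "zeta g l z r \<eta> = l * (snd z + snd r * \<eta>) - ext_envelope g (fst z + \<eta> *\<^sub>R fst r)"

text \<open>
  The subgradient choice in the algorithm is nondeterministic; it is resolved by an
  arbitrary oracle \<open>sel\<close>, which may depend on the iteration counter and on the iterate.
\<close>

definition argmax_oracle ::
    "(real^'n \<Rightarrow> real) \<Rightarrow> (real^'n) \<times> real \<Rightarrow> (real^'n) \<times> real \<Rightarrow> (nat \<Rightarrow> real \<Rightarrow> real^'n) \<Rightarrow> bool" where
  "argmax_oracle g z r sel \<longleftrightarrow>
     (\<forall>i. \<forall>\<eta>\<ge>0. is_arg_max (\<lambda>s. s \<bullet> (fst z + \<eta> *\<^sub>R fst r))
                    (\<lambda>s. s extreme_point_of EPM g) (sel i \<eta>))"

text \<open>Loop state: iteration counter, current iterate, and whether the loop was left by a break.\<close>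

definition newton_body ::
    "(real \<Rightarrow> real) \<Rightarrow> real \<Rightarrow> (real^'n) \<times> real \<Rightarrow> (nat \<Rightarrow> real \<Rightarrow> real^'n) \<Rightarrow>
     nat \<times> real \<times> bool \<Rightarrow> nat \<times> real \<times> bool" where
  "newton_body \<zeta> l r sel = (\<lambda>(i, \<eta>, brk).
     let s = sel i \<eta>; \<beta> = l * snd r - s \<bullet> fst r in
     if \<zeta> \<eta> = 0 then (i, \<eta>, True)
     else if \<beta> < 0 then (i + 1, \<eta> - \<zeta> \<eta> / \<beta>, False)
     else (i + 1, 2 * \<eta>, False))"

text \<open>
  The result is \<open>None\<close> if the loop does not terminate, which is possible a priori only
  for the iteration limit \<open>I = \<infinity>\<close>, and otherwise the final iterate.
\<close>

definition hybrid_newton ::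
    "(real \<Rightarrow> real) \<Rightarrow> real \<Rightarrow> (real^'n) \<times> real \<Rightarrow> (nat \<Rightarrow> real \<Rightarrow> real^'n) \<Rightarrow>
     real \<Rightarrow> real \<Rightarrow> enat \<Rightarrow> real option" where
  "hybrid_newton \<zeta> l r sel \<Delta> \<eta>inf I =
     (if \<zeta> \<eta>inf > 0 then Some \<eta>inf
      else map_option (\<lambda>(i, \<eta>, brk). \<eta>)
             (while_option (\<lambda>(i, \<eta>, brk). \<not> brk \<and> enat i < I)
                (newton_body \<zeta> l r sel) (0, \<Delta>, False)))"

end

theory Submission
  imports Defs
begin

text \<open>
  Along the ray, \<open>\<zeta> = zeta g l z r\<close> is the minimum of finitely many affine functions, one for each
  vertex \<open>s\<close> of \<open>EPM g\<close>, and the number \<open>\<beta>\<close> computed by the algorithm is the slope of a line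
  that is active at the current iterate. Convergence rests on two consequences: \<open>\<beta>\<close> is a
  supergradient of \<open>\<zeta>\<close>, and it takes finitely many values.

  A Newton step moves to the zero of a line lying above \<open>\<zeta>\<close>, so it ends at a point
  where \<open>\<zeta> \<le> 0\<close>, and it never jumps to the left of a point where \<open>\<zeta> \<ge> 0\<close>. Doubling
  steps are made only while \<open>\<zeta> > 0\<close>, and they stop because \<open>\<zeta> \<le> 0\<close> far out. Once
  \<open>\<zeta> < 0\<close>, every step is a Newton step and the slopes increase strictly
  (\<open>negative_newton_step\<close>); as there are only finitely many slopes, a zero is reached
  (\<open>newton_iterate_reaches_zero\<close>).

  If \<open>\<zeta> 0 > 0\<close>, then \<open>\<zeta>\<close> is negative after any positive zero, so such a zero is the
  step length, and the safeguard fires exactly when the step length is infinite. Since \<open>z\<close> is an interior point, \<open>\<zeta> 0 > 0\<close> fails only if \<open>l = 0\<close> and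
  the envelope vanishes at \<open>fst z\<close>. In that case \<open>0\<close> is a vertex of \<open>EPM g\<close>, so \<open>\<zeta> \<le> 0\<close>
  everywhere, and \<open>\<zeta>\<close> vanishes on an initial piece of the ray. No Newton step ends to the left
  of that piece's right end, which is why the zero found is still positive.
\<close>

section \<open>Newton steps for a function with finitely many supergradients\<close>

definition newton_step :: "(real \<Rightarrow> real) \<Rightarrow> (nat \<Rightarrow> real \<Rightarrow> real) \<Rightarrow> nat \<Rightarrow> real \<Rightarrow> real" where
  "newton_step \<zeta> \<beta> i \<eta> = (if \<beta> i \<eta> < 0 then \<eta> - \<zeta> \<eta> / \<beta> i \<eta> else 2 * \<eta>)"

primrec newton_iterate ::
    "(real \<Rightarrow> real) \<Rightarrow> (nat \<Rightarrow> real \<Rightarrow> real) \<Rightarrow> real \<Rightarrow> nat \<Rightarrow> real" where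
  "newton_iterate \<zeta> \<beta> \<Delta> 0 = \<Delta>"
| "newton_iterate \<zeta> \<beta> \<Delta> (Suc i) = newton_step \<zeta> \<beta> i (newton_iterate \<zeta> \<beta> \<Delta> i)"

locale finite_supergradient =
  fixes \<zeta> :: "real \<Rightarrow> real" and \<beta> :: "nat \<Rightarrow> real \<Rightarrow> real" and B :: "real set"
  assumes finite_slopes: "finite B"
    and slope_in: "0 \<le> \<eta> \<Longrightarrow> \<beta> i \<eta> \<in> B"
    and supergradient: "0 \<le> \<eta> \<Longrightarrow> 0 \<le> \<eta>' \<Longrightarrow> \<zeta> \<eta>' \<le> \<zeta> \<eta> + \<beta> i \<eta> * (\<eta>' - \<eta>)"
begin

text \<open>
  The line active at \<open>\<eta>\<close> lies above \<open>\<zeta>\<close>, so it is nonnegative at \<open>p\<close>; if it decreases, its zero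
  cannot be before \<open>p\<close>. This keeps the iterates away from \<open>0\<close>.
\<close>

lemma newton_step_lower_bound:
  assumes "0 \<le> \<zeta> p" "0 \<le> p" "0 \<le> \<eta>"
  shows "min p \<eta> \<le> newton_step \<zeta> \<beta> i \<eta>"
proof (cases "\<beta> i \<eta> < 0")
  case True
  have "\<beta> i \<eta> * (newton_step \<zeta> \<beta> i \<eta> - p) = \<beta> i \<eta> * (\<eta> - p) - \<zeta> \<eta>"
    using True by (simp add: newton_step_def field_simps)
  also have "\<dots> \<le> 0"
    using supergradient[of \<eta> p i] assms by (simp add: algebra_simps)
  finally have "p \<le> newton_step \<zeta> \<beta> i \<eta>"
    using True by (simp add: mult_le_0_iff)
  then show ?thesis by simp
next
  case False
  then show ?thesis using assms by (simp add: newton_step_def)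
qed

lemma newton_iterate_pos:
  assumes "0 \<le> \<zeta> p" "0 < p" "0 < \<Delta>"
  shows "0 < newton_iterate \<zeta> \<beta> \<Delta> k"
proof (induction k)
  case (Suc k)
  then show ?case
    using newton_step_lower_bound[of p "newton_iterate \<zeta> \<beta> \<Delta> k" k] assms by auto
qed (use assms in simp)

lemma newton_step_nonpos:
  assumes "\<beta> i \<eta> < 0" "0 \<le> \<eta>" "0 \<le> newton_step \<zeta> \<beta> i \<eta>"
  shows "\<zeta> (newton_step \<zeta> \<beta> i \<eta>) \<le> 0"
  using supergradient[of \<eta> "newton_step \<zeta> \<beta> i \<eta>" i] assms
  by (simp add: newton_step_def)

lemma slope_neg:
  assumes "0 \<le> \<zeta> 0" "0 < \<eta>" "\<zeta> \<eta> < 0"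
  shows "\<beta> i \<eta> < 0"
proof -
  have "\<beta> i \<eta> * \<eta> < 0"
    using supergradient[of \<eta> 0 i] assms by simp
  then show ?thesis using assms by (simp add: mult_less_0_iff)
qed

text \<open>
  The Newton step from \<open>\<eta>\<close> goes to the left. The line active at the new point is strictly below the old
  line there, but not below it at \<open>\<eta>\<close>, so it must be strictly less steep.
\<close>

lemma negative_newton_step:
  assumes "0 \<le> \<zeta> 0" "0 < \<eta>" "\<zeta> \<eta> < 0"
    and "0 < newton_step \<zeta> \<beta> i \<eta>" "\<zeta> (newton_step \<zeta> \<beta> i \<eta>) < 0"
  shows "\<beta> i \<eta> < \<beta> j (newton_step \<zeta> \<beta> i \<eta>)"
proof -
  let ?\<eta>' = "newton_step \<zeta> \<beta> i \<eta>"
  have neg: "\<beta> i \<eta> < 0" using slope_neg assms by blast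
  then have left: "0 < \<eta> - ?\<eta>'" and active: "\<beta> i \<eta> * (\<eta> - ?\<eta>') = \<zeta> \<eta>"
    using assms(3) by (simp_all add: newton_step_def divide_neg_neg)
  have "\<beta> i \<eta> * (\<eta> - ?\<eta>') < \<beta> j ?\<eta>' * (\<eta> - ?\<eta>')"
    using supergradient[of ?\<eta>' \<eta> j] active assms by simp
  then show ?thesis using left by simp
qed

lemma newton_iterate_reaches_zero:
  assumes "0 \<le> \<zeta> 0" "0 \<le> \<zeta> p" "0 < p" "0 < \<Delta>"
    and far: "\<And>\<eta>. q \<le> \<eta> \<Longrightarrow> \<zeta> \<eta> \<le> 0"
  shows "\<exists>k. \<zeta> (newton_iterate \<zeta> \<beta> \<Delta> k) = 0"
proof (rule ccontr)
  assume "\<not> ?thesis"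
  then have nz: "\<zeta> (newton_iterate \<zeta> \<beta> \<Delta> k) \<noteq> 0" for k by blast
  define e where "e = newton_iterate \<zeta> \<beta> \<Delta>"
  have step: "e (Suc k) = newton_step \<zeta> \<beta> k (e k)" for k by (simp add: e_def)
  have pos: "0 < e k" for k using newton_iterate_pos assms by (simp add: e_def)
  have newton: "\<zeta> (e (Suc k)) < 0" if "\<beta> k (e k) < 0" for k
    using newton_step_nonpos[OF that] pos[of k] pos[of "Suc k"] nz[of "Suc k"]
    by (simp add: step e_def)
  obtain K where K: "\<zeta> (e K) < 0"
  proof (rule ccontr)
    assume "\<not> thesis"
    then have none: "\<not> \<zeta> (e k) < 0" for k using that by blast
    have double: "e k = 2 ^ k * \<Delta>" for k
    proof (induction k)
      case (Suc k)
      then show ?case using newton[of k] none[of "Suc k"] step[of k]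
        by (auto simp: newton_step_def)
    qed (simp add: e_def)
    obtain k where "q / \<Delta> < 2 ^ k" using real_arch_pow[of 2 "q / \<Delta>"] by auto
    then have "q \<le> e k" using \<open>0 < \<Delta>\<close> double by (simp add: field_simps)
    then show False using far none nz[of k] by (metis e_def linorder_neqE less_le_not_le)
  qed
  have negative: "\<zeta> (e (K + k)) < 0" for k
  proof (induction k)
    case (Suc k)
    then show ?case using newton[of "K + k"] slope_neg assms(1) pos by simp
  qed (use K in simp)
  have "strict_mono (\<lambda>k. \<beta> (K + k) (e (K + k)))"
    unfolding strict_mono_Suc_iff
    using negative_newton_step[OF assms(1) pos negative] negative pos
    by (metis add_Suc_right step)
  then have "infinite (range (\<lambda>k. \<beta> (K + k) (e (K + k))))"
    using finite_imageD strict_mono_imp_inj_on infinite_UNIV_nat by blast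
  moreover have "range (\<lambda>k. \<beta> (K + k) (e (K + k))) \<subseteq> B"
    using slope_in pos by (auto simp: less_imp_le)
  ultimately show False using finite_slopes finite_subset by blast
qed

text \<open>A line active at \<open>\<eta>\<close> is positive at \<open>0\<close> and nonpositive at \<open>\<eta>\<close>, hence decreasing.\<close>

lemma negative_after_nonpos:
  assumes "0 < \<zeta> 0" "0 < \<eta>" "\<zeta> \<eta> \<le> 0" "\<eta> < \<eta>'"
  shows "\<zeta> \<eta>' < 0"
proof -
  have "\<beta> 0 \<eta> * \<eta> < 0" using supergradient[of \<eta> 0 0] assms by simp
  then have "\<beta> 0 \<eta> * (\<eta>' - \<eta>) < 0" using assms by (simp add: mult_less_0_iff)
  then show ?thesis using supergradient[of \<eta> \<eta>' 0] assms by simp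
qed

text \<open>The finitely many slopes bound the rate at which \<open>\<zeta>\<close> can decrease.\<close>

lemma nonneg_beyond_positive:
  assumes "0 \<le> \<eta>" "0 < \<zeta> \<eta>"
  obtains \<eta>' where "\<eta> < \<eta>'" "0 \<le> \<zeta> \<eta>'"
proof -
  obtain M where M: "0 < M" "\<And>b. b \<in> B \<Longrightarrow> \<bar>b\<bar> \<le> M"
    using finite_imp_bounded[OF finite_slopes] bounded_pos by (metis real_norm_def)
  let ?\<eta>' = "\<eta> + \<zeta> \<eta> / M"
  have gt: "\<eta> < ?\<eta>'" using M assms by simp
  have "- M \<le> \<beta> 0 ?\<eta>'" using M(2)[OF slope_in[of ?\<eta>' 0]] gt assms by linarith
  then have "- M * (\<zeta> \<eta> / M) \<le> \<beta> 0 ?\<eta>' * (\<zeta> \<eta> / M)"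
    using M assms by (intro mult_right_mono) auto
  then have "0 \<le> \<zeta> ?\<eta>'" using supergradient[of ?\<eta>' \<eta> 0] gt assms M by simp
  then show ?thesis using that gt by blast
qed

end

section \<open>The loop computes the Newton iterates\<close>

text \<open>
  The loop stops with the right value also if the iteration limit equals the index \<open>k\<close> of the
  first zero: the limit is then hit at the very iterate at which the loop would break.
\<close>

lemma hybrid_newton_eq_iterate:
  fixes r :: "(real^'n) \<times> real" and \<zeta> sel l \<Delta>
  defines "e \<equiv> newton_iterate \<zeta> (\<lambda>i \<eta>. l * snd r - sel i \<eta> \<bullet> fst r) \<Delta>"
  assumes "\<not> 0 < \<zeta> \<eta>inf" "\<zeta> (e k) = 0" "\<And>j. j < k \<Longrightarrow> \<zeta> (e j) \<noteq> 0" "enat k \<le> I"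
  shows "hybrid_newton \<zeta> l r sel \<Delta> \<eta>inf I = Some (e k)"
proof -
  let ?C = "\<lambda>(i, \<eta>, brk). \<not> brk \<and> enat i < I"
  let ?W = "while_option ?C (newton_body \<zeta> l r sel)"
  have "map_option (\<lambda>(i, \<eta>, brk). \<eta>) (?W (k - j, e (k - j), False)) = Some (e k)" if "j \<le> k" for j
    using that
  proof (induction j)
    case 0
    have "newton_body \<zeta> l r sel (k, e k, False) = (k, e k, True)"
      using assms(3) by (simp add: newton_body_def)
    then show ?case
      by (auto simp: while_option_unfold[of _ _ "(k, e k, False)"]
          while_option_unfold[of _ _ "(k, e k, True)"])
  next
    case (Suc j)
    let ?i = "k - Suc j"
    have "?i < k" and next_i: "k - j = Suc ?i" using Suc.prems by auto
    then have "?C (?i, e ?i, False)"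
      using \<open>enat k \<le> I\<close> by (simp add: less_le_trans[of _ "enat k"])
    moreover have "newton_body \<zeta> l r sel (?i, e ?i, False) = (k - j, e (k - j), False)"
      using assms(4)[OF \<open>?i < k\<close>] unfolding next_i
      by (simp add: newton_body_def e_def newton_step_def)
    ultimately have "?W (?i, e ?i, False) = ?W (k - j, e (k - j), False)"
      by (subst while_option_unfold) simp
    then show ?case using Suc by simp
  qed
  from this[of k] have "map_option (\<lambda>(i, \<eta>, brk). \<eta>) (?W (0, \<Delta>, False)) = Some (e k)"
    by (simp add: e_def)
  then show ?thesis using assms(2) by (simp add: hybrid_newton_def)
qed

section \<open>The envelope along a ray\<close>

lemma finite_binary: "finite (binary :: (real^'n) set)"
proof (rule finite_surj)
  show "finite (UNIV :: 'n set set)" by simp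
  have "x = (\<chi> i. if i \<in> {i. x $ i = 1} then 1 else 0)" if "x \<in> binary" for x :: "real^'n"
    using that by (auto simp: binary_def vec_eq_iff)
  then show "binary \<subseteq> (\<lambda>S :: 'n set. (\<chi> i. if i \<in> S then 1 else 0) :: real^'n) ` UNIV"
    by blast
qed

lemma finite_vertices_EPM: "finite {s. s extreme_point_of EPM g}"
proof -
  have "EPM g = (\<Inter>x\<in>binary. {s. x \<bullet> s \<le> g x})"
    by (auto simp: EPM_def inner_commute)
  moreover have "polyhedron \<dots>"
    using finite_binary by (intro polyhedron_Inter) (auto simp: polyhedron_halfspace_le)
  ultimately show ?thesis by (metis finite_polyhedron_extreme_points)
qed

lemma inner_le_ext_envelope: "s extreme_point_of EPM g \<Longrightarrow> s \<bullet> x \<le> ext_envelope g x"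
  unfolding ext_envelope_def using finite_vertices_EPM[of g] by (intro Max_ge) auto

lemma arg_max_vertex_attains_envelope:
  assumes "is_arg_max (\<lambda>s. s \<bullet> x) (\<lambda>s. s extreme_point_of EPM g) s"
  shows "s \<bullet> x = ext_envelope g x"
  unfolding ext_envelope_def using assms finite_vertices_EPM[of g]
  by (intro Max_eqI[symmetric]) (auto simp: is_arg_max_def not_less)

lemma zeta_finite_supergradient:
  assumes "argmax_oracle g z r sel"
  shows "finite_supergradient (zeta g l z r) (\<lambda>i \<eta>. l * snd r - sel i \<eta> \<bullet> fst r)
           ((\<lambda>s. l * snd r - s \<bullet> fst r) ` {s. s extreme_point_of EPM g})"
proof
  fix i and \<eta> \<eta>' :: real
  assume "0 \<le> \<eta>"
  then have arg: "is_arg_max (\<lambda>s. s \<bullet> (fst z + \<eta> *\<^sub>R fst r)) (\<lambda>s. s extreme_point_of EPM g) (sel i \<eta>)"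
    using assms by (simp add: argmax_oracle_def)
  then have vertex: "sel i \<eta> extreme_point_of EPM g" by (simp add: is_arg_max_def)
  then show "l * snd r - sel i \<eta> \<bullet> fst r \<in> (\<lambda>s. l * snd r - s \<bullet> fst r) ` {s. s extreme_point_of EPM g}"
    by blast
  show "zeta g l z r \<eta>' \<le> zeta g l z r \<eta> + (l * snd r - sel i \<eta> \<bullet> fst r) * (\<eta>' - \<eta>)"
    using inner_le_ext_envelope[OF vertex, of "fst z + \<eta>' *\<^sub>R fst r"]
      arg_max_vertex_attains_envelope[OF arg]
    by (simp add: zeta_def algebra_simps)
qed (simp add: finite_vertices_EPM)

lemma mem_envelope_set_iff: "z + \<eta> *\<^sub>R r \<in> envelope_set g l \<longleftrightarrow> 0 \<le> zeta g l z r \<eta>"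
  by (simp add: envelope_set_def zeta_def case_prod_beta algebra_simps)

lemma step_length_eq_zero:
  assumes "argmax_oracle g z r sel" "0 < zeta g l z r 0" "0 < \<eta>" "zeta g l z r \<eta> = 0"
  shows "step_length g l z r = ereal \<eta>"
proof -
  interpret finite_supergradient "zeta g l z r" "\<lambda>i \<eta>. l * snd r - sel i \<eta> \<bullet> fst r"
    "(\<lambda>s. l * snd r - s \<bullet> fst r) ` {s. s extreme_point_of EPM g}"
    using zeta_finite_supergradient assms(1) .
  show ?thesis
    unfolding step_length_def mem_envelope_set_iff
  proof (rule antisym)
    show "(SUP \<eta>\<in>{\<eta>. 0 \<le> \<eta> \<and> 0 \<le> zeta g l z r \<eta>}. ereal \<eta>) \<le> ereal \<eta>"
      using negative_after_nonpos[of \<eta>] assms by (intro SUP_least) (force simp: not_le[symmetric])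
    show "ereal \<eta> \<le> (SUP \<eta>\<in>{\<eta>. 0 \<le> \<eta> \<and> 0 \<le> zeta g l z r \<eta>}. ereal \<eta>)"
      using assms by (intro SUP_upper) simp
  qed
qed

section \<open>Starting from an interior point\<close>

lemma interior_move:
  fixes z d :: "'a::real_normed_vector"
  assumes "z \<in> interior S"
  obtains e where "0 < e" "z + e *\<^sub>R d \<in> S"
proof -
  obtain \<epsilon> where \<epsilon>: "0 < \<epsilon>" "ball z \<epsilon> \<subseteq> S" using assms mem_interior by blast
  let ?e = "\<epsilon> / (1 + norm d)"
  have pos: "0 < 1 + norm d" by (smt (verit) norm_ge_zero)
  have "?e * norm d < \<epsilon>" using \<epsilon> pos by (simp add: field_simps)
  then have "z + ?e *\<^sub>R d \<in> ball z \<epsilon>" using \<epsilon> pos by (simp add: dist_norm)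
  then show ?thesis using that[of ?e] \<epsilon> pos by auto
qed

text \<open>
  A vertex \<open>s\<close> attaining the value \<open>0\<close> of the envelope at \<open>fst z\<close> has to be \<open>0\<close>: otherwise moving from \<open>z\<close>
  in the direction \<open>s\<close> would make the envelope positive, but \<open>z\<close> is an interior point.
\<close>

lemma ext_envelope_nonneg:
  assumes "z \<in> interior (envelope_set g 0)" "ext_envelope g (fst z) = 0"
    and "s extreme_point_of EPM g" "s \<bullet> fst z = 0"
  shows "0 \<le> ext_envelope g x"
proof -
  obtain e where e: "0 < e" "z + e *\<^sub>R (s, 0) \<in> envelope_set g 0"
    using interior_move[OF assms(1)] .
  then have "ext_envelope g (fst z + e *\<^sub>R s) \<le> 0"
    by (simp add: envelope_set_def case_prod_beta)
  then have "e * (s \<bullet> s) \<le> 0"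
    using inner_le_ext_envelope[OF assms(3), of "fst z + e *\<^sub>R s"] assms(4)
    by (simp add: inner_add_right)
  then have "s = 0"
    using e(1) by (metis inner_gt_zero_iff mult_pos_pos not_less)
  then show ?thesis using inner_le_ext_envelope[OF assms(3), of x] by simp
qed

text \<open>
  For \<open>l = 1\<close> the last coordinate can be decreased slightly without leaving the set, which makes its
  defining inequality strict; for \<open>l = 0\<close> only the excluded case is not strict.
\<close>

lemma zeta_0_pos:
  assumes "z \<in> interior (envelope_set g l)" "l \<in> {0, 1}" "\<not> (l = 0 \<and> ext_envelope g (fst z) = 0)"
  shows "0 < zeta g l z r 0"
proof -
  obtain e where e: "0 < e" "z + e *\<^sub>R (0, -1) \<in> envelope_set g l"
    using interior_move[OF assms(1)] .
  then show ?thesis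
    using assms(2,3) by (auto simp: envelope_set_def zeta_def case_prod_beta)
qed

section \<open>Correctness and termination\<close>

theorem proposition12:
  fixes g :: "real^'n \<Rightarrow> real" and l \<Delta> \<eta>inf :: real
    and z r :: "(real^'n) \<times> real" and P R :: "((real^'n) \<times> real) set"
    and sel :: "nat \<Rightarrow> real \<Rightarrow> real^'n"
  assumes "submodular g" and "g 0 = 0"
    and "l \<in> {0, 1}"
    and "z \<in> interior (envelope_set g l)"
    and "corner_polyhedron P z R" and "r \<in> R"
    and "argmax_oracle g z r sel"
    and "\<Delta> > 0"
    and "\<eta>inf > 0" and "step_length g l z r < \<infinity> \<Longrightarrow> step_length g l z r \<le> ereal \<eta>inf"
  shows "\<exists>\<eta>. (\<exists>N::nat. \<forall>I\<ge>enat N. hybrid_newton (zeta g l z r) l r sel \<Delta> \<eta>inf I = Some \<eta>) \<and>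
     (if l = 0 \<and> ext_envelope g (fst z) = 0 then \<eta> > 0 \<and> zeta g l z r \<eta> = 0
      else if step_length g l z r = \<infinity> then \<eta> = \<eta>inf
      else ereal \<eta> = step_length g l z r \<and> zeta g l z r \<eta> = 0)"
proof -
  let ?\<zeta> = "zeta g l z r" and ?\<beta> = "\<lambda>i \<eta>. l * snd r - sel i \<eta> \<bullet> fst r"
  let ?degenerate = "l = 0 \<and> ext_envelope g (fst z) = 0"
  interpret finite_supergradient ?\<zeta> ?\<beta>
    "(\<lambda>s. l * snd r - s \<bullet> fst r) ` {s. s extreme_point_of EPM g}"
    using zeta_finite_supergradient assms(7) .
  have nonneg_0: "0 \<le> ?\<zeta> 0"
    using interior_subset assms(4) mem_envelope_set_iff[of z 0 r g l] by auto
  obtain p where p: "0 < p" "0 \<le> ?\<zeta> p"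
    using interior_move[OF assms(4), of r] unfolding mem_envelope_set_iff .
  have degenerate: "?\<zeta> \<eta> \<le> 0" if ?degenerate for \<eta>
  proof -
    have arg: "is_arg_max (\<lambda>s. s \<bullet> fst z) (\<lambda>s. s extreme_point_of EPM g) (sel 0 0)"
      using assms(7)[unfolded argmax_oracle_def, rule_format, of 0 0] by simp
    then have "sel 0 0 extreme_point_of EPM g" by (simp add: is_arg_max_def)
    moreover have "sel 0 0 \<bullet> fst z = 0"
      using arg_max_vertex_attains_envelope[OF arg] that by simp
    ultimately have "0 \<le> ext_envelope g x" for x
      using ext_envelope_nonneg assms(4) that by blast
    then show ?thesis using that by (simp add: zeta_def)
  qed
  have pos_0: "0 < ?\<zeta> 0" if "\<not> ?degenerate"
    using zeta_0_pos assms(3,4) that by blast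
  show ?thesis
  proof (cases "0 < ?\<zeta> \<eta>inf")
    case True
    obtain \<eta>' where "\<eta>inf < \<eta>'" "0 \<le> ?\<zeta> \<eta>'"
      using nonneg_beyond_positive[OF less_imp_le[OF \<open>\<eta>inf > 0\<close>] True] .
    then have "ereal \<eta>' \<le> step_length g l z r"
      using \<open>\<eta>inf > 0\<close> unfolding step_length_def mem_envelope_set_iff
      by (intro SUP_upper) simp
    then have "\<not> step_length g l z r \<le> ereal \<eta>inf"
      using \<open>\<eta>inf < \<eta>'\<close> order_trans by fastforce
    then have "step_length g l z r = \<infinity>" using assms(10) by auto
    moreover have "\<not> ?degenerate" using degenerate[of \<eta>inf] True by linarith
    moreover have "hybrid_newton ?\<zeta> l r sel \<Delta> \<eta>inf I = Some \<eta>inf" for I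
      using True by (simp add: hybrid_newton_def)
    ultimately show ?thesis by auto
  next
    case False
    let ?e = "newton_iterate ?\<zeta> ?\<beta> \<Delta>"
    have "?\<zeta> \<eta> \<le> 0" if "\<eta>inf \<le> \<eta>" for \<eta>
    proof (cases ?degenerate)
      case not_degenerate: False
      show ?thesis
        using negative_after_nonpos[OF pos_0[OF not_degenerate] \<open>\<eta>inf > 0\<close>, of \<eta>] False that
        by (cases "\<eta> = \<eta>inf") auto
    qed (rule degenerate)
    then have "\<exists>k. ?\<zeta> (?e k) = 0"
      using newton_iterate_reaches_zero nonneg_0 p \<open>\<Delta> > 0\<close> by blast
    then obtain k where k: "?\<zeta> (?e k) = 0" "\<And>j. j < k \<Longrightarrow> ?\<zeta> (?e j) \<noteq> 0"
      unfolding exists_least_iff[of "\<lambda>k. ?\<zeta> (?e k) = 0"] by blast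
    have run: "\<forall>I\<ge>enat k. hybrid_newton ?\<zeta> l r sel \<Delta> \<eta>inf I = Some (?e k)"
      using hybrid_newton_eq_iterate[of ?\<zeta> \<eta>inf l r sel \<Delta> k] False k by blast
    have pos: "0 < ?e k" using newton_iterate_pos p \<open>\<Delta> > 0\<close> by blast
    have "step_length g l z r = ereal (?e k)" if "\<not> ?degenerate"
      using step_length_eq_zero assms(7) pos_0[OF that] pos k(1) .
    then show ?thesis using run pos k(1) by auto
  qed
qed

end
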